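(* Let $f:\{0,1\}^n\to\{0,1\}$ be the decision function of a binary classifier, $OBDD_f$ an ordered binary decision diagram representing $f$, and $\Sigma_f$ the CNF encoding obtained from $OBDD_f$. Let $x\in\{0,1\}^n$ be a data instance predicted negatively, $f(x)=0$, with $\Sigma_x$ the set of unit clauses encoding $x$, so that $\Sigma_f\wedge\Sigma_x$ is an unsatisfiable CNF. Let $CF(x,f)$ be the set of counterfactual explanations of $x$ with respect to $f$, and let $MCS(\Sigma_{f,x})$ be the set of minimal correction subsets of $\Sigma_f\wedge\Sigma_x$, where the clauses of $\Sigma_f$ are hard and the clauses of $\Sigma_x$ are soft. Then, identifying parts of $x$ with sets of unit clauses of $\Sigma_x$, $$\forall\, \acute{x}\subseteq x,\qquad \acute{x}\in CF(x,f)\iff \acute{x}\in MCS(\Sigma_{f,x}).$$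
   Context: A binary classifier has a finite set of binary features $X=\{X_1,\dots,X_n\}$ and a binary class variable $Y$; its decision function is a function $f:\{0,1\}^n\to\{0,1\}$ mapping each instantiation $x$ of $X$ to a class $f(x)$. An ordered binary decision diagram (OBDD) over the ordered variables $X_1,\dots,X_n$ is a rooted directed acyclic graph whose sink (terminal) nodes are labeled by $0$ or $1$ and in which every non-sink node is labeled by a variable $X_i$ and has exactly two outgoing edges, one for each value $0,1$ of $X_i$; if there is an edge from a node labeled $X_i$ to a node labeled $X_j$ then $i<j$ (so variables may be skipped along a path). It represents $f$ if, for every $x\in\{0,1\}^n$, following from the root, at each node labeled $X_i$, the edge for the value $x_i$ leads to the sink labeled $f(x)$. Sinks labeled $0$ are referred to as the $0$-sink. CNF encoding: each path from the root to the $0$-sink assigns a value to each variable labeling a node on the path, according to the edge taken. This partial assignment $e$ is identified with the conjunction of the corresponding literals ($X_i$ if the value is $1$, $\neg X_i$ if the value is $0$). The off-set $f^0$ is the set of all such $e$. The negation $\neg e$ is a clause (the empty clause, which is false, if $e$ is empty), and $\Sigma_f=\bigwedge_{e\in f^0}\neg e$, a CNF formula over $X_1,\dots,X_n$ (the empty conjunction being true). For $x=(x_1,\dots,x_n)\in\{0,1\}^n$, $\Sigma_x$ is the CNF consisting of the $n$ unit clauses: $X_i$ if $x_i=1$ and $\neg X_i$ if $x_i=0$, for $i=1,\dots,n$. A part $\acute{x}\subseteq x$ is the restriction of the assignment $x$ to a subset of the variables; equivalently, it is a subset of the literals of $x$, and it is identified with the corresponding subset of the unit clauses of $\Sigma_x$.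 Counterfactual explanation: for $\acute{x}\subseteq x$, let $x[\acute{x}]$ be the data instance obtained from $x$ by reversing (flipping) the values of the variables included in $\acute{x}$. A counterfactual explanation of $x$ with respect to $f$ is a part $\acute{x}\subseteq x$ such that $f(x[\acute{x}])=1-f(x)$ and there is no strict subset $\hat{x}\subset\acute{x}$ with $f(x[\hat{x}])=f(x[\acute{x}])$. MSS and MCS: a maximal satisfiable subset (MSS) of a CNF $\Sigma$ (viewed as a set of clauses) is a satisfiable subset $\Phi\subseteq\Sigma$ such that $\Phi\cup\{\alpha\}$ is unsatisfiable for every $\alpha\in\Sigma\setminus\Phi$; a minimal correction subset (MCS) of $\Sigma$ is a set $\Psi\subseteq\Sigma$ such that $\Sigma\setminus\Psi$ is an MSS of $\Sigma$. With hard clauses $\Sigma_f$ and soft clauses $\Sigma_x$, hard clauses cannot be included in an MCS: $MCS(\Sigma_{f,x})$ is the set of those MCSs $\Psi$ of $\Sigma_f\cup\Sigma_x$ with $\Psi\subseteq\Sigma_x$, i.e. of those $\Psi\subseteq\Sigma_x$ such that $\Sigma_f\cup(\Sigma_x\setminus\Psi)$ is satisfiable and $\Sigma_f\cup(\Sigma_x\setminus\Psi)\cup\{\alpha\}$ is unsatisfiable for every $\alpha\in\Psi$. (Here hard and soft clauses are kept as disjoint, separately tracked sets: a unit clause of $\Sigma_x$ is treated as soft even if the same clause also occurs in $\Sigma_f$.) *)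

theory Defs
  imports Main "HOL-Library.FuncSet" "Graph_Theory.Digraph" "Graph_Theory.Arc_Walk"
begin

text \<open>
  The values 1 and 0 of features and classes are \<^const>\<open>True\<close> and \<^const>\<open>False\<close>.
  The feature \<open>X\<^sub>i\<close> is represented by its index \<open>i \<in> {1..n}\<close>.  A decision function is
  a function on \<^typ>\<open>nat \<Rightarrow> bool\<close> of which only the values on \<open>instances n\<close> matter.
\<close>

definition instances :: "nat \<Rightarrow> (nat \<Rightarrow> bool) set" where
  "instances n = {1..n} \<rightarrow>\<^sub>E UNIV"

datatype literal = Pos (var: nat) | Neg (var: nat)

fun neg :: "literal \<Rightarrow> literal" where
  "neg (Pos i) = Neg i"
| "neg (Neg i) = Pos i"

fun lit_true :: "(nat \<Rightarrow> bool) \<Rightarrow> literal \<Rightarrow> bool" where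
  "lit_true v (Pos i) = v i"
| "lit_true v (Neg i) = (\<not> v i)"

definition assign_lit :: "nat \<Rightarrow> bool \<Rightarrow> literal" where
  "assign_lit i b = (if b then Pos i else Neg i)"

type_synonym clause = "literal set"
type_synonym cnf = "clause set"

definition satisfies :: "(nat \<Rightarrow> bool) \<Rightarrow> cnf \<Rightarrow> bool" where
  "satisfies v \<Sigma> \<longleftrightarrow> (\<forall>C\<in>\<Sigma>. \<exists>l\<in>C. lit_true v l)"

definition satisfiable :: "cnf \<Rightarrow> bool" where
  "satisfiable \<Sigma> \<longleftrightarrow> (\<exists>v. satisfies v \<Sigma>)"

text \<open>
  The hard clauses \<open>H\<close> and the soft clauses \<open>S\<close> are kept apart: a clause that occurs in both
  may still be removed from \<open>S\<close>.  For \<open>H = {}\<close> these are the ordinary maximal satisfiable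
  subsets and minimal correction subsets of \<open>S\<close>.
\<close>

definition MSS :: "cnf \<Rightarrow> cnf \<Rightarrow> cnf set" where
  "MSS H S = {\<Phi>. \<Phi> \<subseteq> S \<and> satisfiable (H \<union> \<Phi>) \<and>
     (\<forall>\<alpha>\<in>S - \<Phi>. \<not> satisfiable (H \<union> \<Phi> \<union> {\<alpha>}))}"

definition MCS :: "cnf \<Rightarrow> cnf \<Rightarrow> cnf set" where
  "MCS H S = {\<Psi>. \<Psi> \<subseteq> S \<and> S - \<Psi> \<in> MSS H S}"

datatype node_label = Sink bool | Var nat

text \<open>
  Arcs are objects of their own, so the two arcs leaving a node may have the same head;
  \<open>val a\<close> is the value of the tested variable for which the arc \<open>a\<close> is taken.
\<close>

locale obdd = fin_digraph G for G :: "('a, 'b) pre_digraph" (structure) +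
  fixes n :: nat
    and root :: 'a
    and label :: "'a \<Rightarrow> node_label"
    and val :: "'b \<Rightarrow> bool"
  assumes acyclic: "acyclic (arcs_ends G)"
    and root_in_verts: "root \<in> verts G"
    and rooted: "v \<in> verts G \<Longrightarrow> root \<rightarrow>\<^sup>* v"
    and sink: "v \<in> verts G \<Longrightarrow> label v = Sink c \<Longrightarrow> out_arcs G v = {}"
    and non_sink: "v \<in> verts G \<Longrightarrow> label v = Var i \<Longrightarrow>
      i \<in> {1..n} \<and> bij_betw val (out_arcs G v) UNIV"
    and ordered: "a \<in> arcs G \<Longrightarrow> label (tail G a) = Var i \<Longrightarrow> label (head G a) = Var j \<Longrightarrow> i < j"
begin

definition represents :: "((nat \<Rightarrow> bool) \<Rightarrow> bool) \<Rightarrow> bool" where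
  "represents f \<longleftrightarrow> (\<forall>x\<in>instances n. \<exists>p s. awalk root p s \<and>
     (\<forall>a\<in>set p. \<forall>i. label (tail G a) = Var i \<longrightarrow> val a = x i) \<and> label s = Sink (f x))"

definition path_literals :: "'b awalk \<Rightarrow> literal set" where
  "path_literals p = {assign_lit i (val a) | i a. a \<in> set p \<and> label (tail G a) = Var i}"

definition off_set :: "literal set set" where
  "off_set = {path_literals p | p s. awalk root p s \<and> label s = Sink False}"

definition \<Sigma>_f :: cnf where
  "\<Sigma>_f = {neg ` e | e. e \<in> off_set}"

end

definition instance_literals :: "nat \<Rightarrow> (nat \<Rightarrow> bool) \<Rightarrow> literal set" where
  "instance_literals n x = {assign_lit i (x i) | i. i \<in> {1..n}}"

definition unit_clauses :: "literal set \<Rightarrow> cnf" where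
  "unit_clauses e = {{l} | l. l \<in> e}"

definition \<Sigma>_x :: "nat \<Rightarrow> (nat \<Rightarrow> bool) \<Rightarrow> cnf" where
  "\<Sigma>_x n x = unit_clauses (instance_literals n x)"

definition flip :: "(nat \<Rightarrow> bool) \<Rightarrow> literal set \<Rightarrow> nat \<Rightarrow> bool" where
  "flip x e i = (if i \<in> var ` e then \<not> x i else x i)"

definition CF :: "nat \<Rightarrow> (nat \<Rightarrow> bool) \<Rightarrow> ((nat \<Rightarrow> bool) \<Rightarrow> bool) \<Rightarrow> literal set set" where
  "CF n x f = {e. e \<subseteq> instance_literals n x \<and> f (flip x e) = (\<not> f x) \<and>
     \<not> (\<exists>e'. e' \<subset> e \<and> f (flip x e') = f (flip x e))}"

end

theory Submission
  imports Defs
begin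

text \<open>
  An instance determines one path from the root to a sink, so a valuation satisfies \<open>\<Sigma>_f\<close>
  exactly when \<open>f\<close> maps the instance it restricts to to 1.  Hence removing the unit clauses of a
  part \<open>e\<close> of \<open>x\<close> restores satisfiability iff flipping some subset of \<open>e\<close> changes the class, and
  the minimal such \<open>e\<close> are the correction subsets as well as the counterfactual explanations.
\<close>

lemma lit_true_neg: "lit_true v (neg l) \<longleftrightarrow> \<not> lit_true v l"
  by (cases l) auto

lemma lit_true_assign_lit: "lit_true v (assign_lit i b) \<longleftrightarrow> v i = b"
  by (simp add: assign_lit_def)

lemma var_assign_lit: "var (assign_lit i b) = i"
  by (simp add: assign_lit_def)

lemma satisfies_Un: "satisfies v (\<Sigma> \<union> \<Sigma>') \<longleftrightarrow> satisfies v \<Sigma> \<and> satisfies v \<Sigma>'"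
  unfolding satisfies_def by blast

lemma satisfies_unit_clauses: "satisfies v (unit_clauses e) \<longleftrightarrow> (\<forall>l\<in>e. lit_true v l)"
  unfolding satisfies_def unit_clauses_def by auto

lemma unit_clauses_Diff: "unit_clauses (e - e') = unit_clauses e - unit_clauses e'"
  unfolding unit_clauses_def by blast

lemma unit_clauses_mono: "e \<subseteq> e' \<Longrightarrow> unit_clauses e \<subseteq> unit_clauses e'"
  unfolding unit_clauses_def by blast

lemma flip_in_instances:
  assumes "x \<in> instances n" and "e \<subseteq> instance_literals n x"
  shows "flip x e \<in> instances n"
proof -
  have "var ` e \<subseteq> {1..n}"
    using assms(2) by (auto simp: instance_literals_def var_assign_lit)
  then show ?thesis
    using assms(1) unfolding instances_def flip_def PiE_iff extensional_def by auto
qed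

text \<open>Every literal of \<open>x\<close> holds under \<open>x\<close>, and distinct literals of
  \<open>x\<close> have distinct variables. So flipping the variables of \<open>e\<close> falsifies
  the literals in \<open>e\<close> and no others.\<close>

lemma lit_true_flip_iff:
  assumes "l \<in> instance_literals n x" and "e \<subseteq> instance_literals n x"
  shows "lit_true (flip x e) l \<longleftrightarrow> l \<notin> e"
proof -
  obtain i where l: "l = assign_lit i (x i)"
    using assms(1) by (auto simp: instance_literals_def)
  have "i \<in> var ` e \<longleftrightarrow> l \<in> e"
  proof
    assume "i \<in> var ` e"
    then obtain l' where l': "l' \<in> e" "i = var l'"
      by blast
    then obtain j where "l' = assign_lit j (x j)"
      using assms(2) by (auto simp: instance_literals_def)
    then show "l \<in> e"
      using l' by (simp add: l var_assign_lit)
  qed (force simp: l var_assign_lit)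
  then show ?thesis
    by (simp add: l lit_true_assign_lit flip_def)
qed

text \<open>The falsified literals mark exactly the indices where \<open>v\<close> and
  \<open>x\<close> differ. Outside \<open>{1..n}\<close> both sides are \<open>undefined\<close>,
  since \<open>x\<close> is extensional.\<close>

lemma restrict_eq_flip:
  assumes "x \<in> instances n"
  shows "restrict v {1..n} = flip x {l \<in> instance_literals n x. \<not> lit_true v l}"
    (is "_ = flip x ?e")
proof
  fix i
  have "i \<in> var ` ?e \<longleftrightarrow> i \<in> {1..n} \<and> v i \<noteq> x i"
    by (force simp: instance_literals_def var_assign_lit lit_true_assign_lit)
  then show "restrict v {1..n} i = flip x ?e i"
    using assms by (auto simp: flip_def instances_def PiE_iff extensional_def)
qed

text \<open>Restoring one clause \<open>{l}\<close> amounts to removing only \<open>e - {l}\<close>.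
  Correction and minimality thus become satisfiability questions of one shape, each about a removed
  part of \<open>I\<close>.\<close>

lemma MCS_unit_clauses_iff:
  assumes "e \<subseteq> I"
  shows "unit_clauses e \<in> MCS H (unit_clauses I) \<longleftrightarrow>
    satisfiable (H \<union> unit_clauses (I - e)) \<and>
    (\<forall>l\<in>e. \<not> satisfiable (H \<union> unit_clauses (I - (e - {l}))))"
proof -
  \<comment> \<open>The clauses that \<open>MSS\<close> tries to add back are those of
    \<open>e\<close>.\<close>
  have "unit_clauses I - (unit_clauses I - unit_clauses e) = unit_clauses e"
    using unit_clauses_mono[OF assms] by blast
  moreover have "unit_clauses (I - (e - {l})) = unit_clauses (I - e) \<union> {{l}}" if "l \<in> e" for l
    using that assms unfolding unit_clauses_def by blast
  moreover have "(\<forall>\<alpha>\<in>unit_clauses e. P \<alpha>) \<longleftrightarrow> (\<forall>l\<in>e. P {l})" for P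
    unfolding unit_clauses_def by blast
  ultimately show ?thesis
    using unit_clauses_mono[OF assms] by (simp add: MCS_def MSS_def unit_clauses_Diff Un_assoc)
qed

context obdd
begin

definition follows :: "(nat \<Rightarrow> bool) \<Rightarrow> 'b awalk \<Rightarrow> bool" where
  "follows v p \<longleftrightarrow> (\<forall>a\<in>set p. \<forall>i. label (tail G a) = Var i \<longrightarrow> val a = v i)"

lemma follows_Cons:
  "follows v (a # p) \<longleftrightarrow> (\<forall>i. label (tail G a) = Var i \<longrightarrow> val a = v i) \<and> follows v p"
  by (simp add: follows_def)

text \<open>Models of a CNF are valuations of all natural numbers, while \<open>represents\<close>
  speaks of instances only. Nodes test only indices in \<open>{1..n}\<close>, so the other values
  have no effect on a path.\<close>

lemma follows_restrict: "awalk u p s \<Longrightarrow> follows (restrict v {1..n}) p \<longleftrightarrow> follows v p"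
proof -
  assume "awalk u p s"
  then have "set p \<subseteq> arcs G"
    by blast
  then have "restrict v {1..n} i = v i" if "a \<in> set p" "label (tail G a) = Var i" for a i
    using that non_sink[OF tail_in_verts that(2)] by auto
  then show ?thesis
    unfolding follows_def by auto
qed

lemma tail_Var: "a \<in> arcs G \<Longrightarrow> \<exists>i. label (tail G a) = Var i"
proof (cases "label (tail G a)")
  case (Sink c)
  assume "a \<in> arcs G"
  then have "a \<in> out_arcs G (tail G a)"
    by simp
  then show ?thesis
    using sink[OF tail_in_verts[OF \<open>a \<in> arcs G\<close>] Sink] by simp
qed simp

lemma awalk_from_sink: "awalk u p s \<Longrightarrow> label u = Sink c \<Longrightarrow> p = [] \<and> s = u"
proof (cases p)
  case (Cons a p')
  assume "awalk u p s" and "label u = Sink c"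
  then have "a \<in> arcs G" and "label (tail G a) = Sink c"
    by (simp_all add: Cons awalk_Cons_iff)
  then show ?thesis
    using tail_Var by fastforce
qed (simp add: awalk_Nil_iff)

text \<open>At a common node \<open>val\<close> is injective on the outgoing arcs, so both paths
  take the same arc. As both end in sinks, neither can stop earlier than the other.\<close>

lemma follows_unique_sink:
  assumes "awalk u p s" and "label s = Sink c" and "follows v p"
    and "awalk u q t" and "label t = Sink d" and "follows v q"
  shows "s = t"
  using assms
proof (induction p arbitrary: u q)
  case Nil
  then show ?case
    by (metis awalk_from_sink awalk_Nil_iff)
next
  case (Cons a p)
  from Cons.prems(1) have a: "a \<in> arcs G" "tail G a = u" "awalk (head G a) p s"
    by (auto simp: awalk_Cons_iff)
  obtain i where i: "label u = Var i"
    using tail_Var a by blast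
  \<comment> \<open>An empty \<open>q\<close> would make \<open>u\<close> equal to the sink
    \<open>t\<close>, but \<open>u\<close> tests a variable.\<close>
  then obtain b q' where q: "q = b # q'"
    using Cons.prems(4,5) by (cases q) (auto simp: awalk_Nil_iff)
  have b: "b \<in> arcs G" "tail G b = u" "awalk (head G b) q' t"
    using Cons.prems(4) by (auto simp: q awalk_Cons_iff)
  have "inj_on val (out_arcs G u)"
    using non_sink[OF _ i] a(1,2) tail_in_verts bij_betw_imp_inj_on by blast
  moreover have "val a = val b"
    using Cons.prems(3,6) a b i by (simp add: q follows_Cons)
  ultimately have "a = b"
    using a b by (auto dest: inj_onD)
  then show ?case
    using Cons.IH[OF a(3) Cons.prems(2)] Cons.prems(3,5,6) b by (simp add: q follows_Cons)
qed

lemma falsifies_path_clause_iff: "(\<forall>l\<in>neg ` path_literals p. \<not> lit_true v l) \<longleftrightarrow> follows v p"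
proof -
  have "(\<forall>l\<in>neg ` path_literals p. \<not> lit_true v l) \<longleftrightarrow> (\<forall>l\<in>path_literals p. lit_true v l)"
    by (simp add: lit_true_neg)
  also have "\<dots> \<longleftrightarrow> (\<forall>a\<in>set p. \<forall>i. label (tail G a) = Var i \<longrightarrow> lit_true v (assign_lit i (val a)))"
    unfolding path_literals_def by blast
  also have "\<dots> \<longleftrightarrow> follows v p"
    unfolding follows_def lit_true_assign_lit by metis
  finally show ?thesis .
qed

lemma satisfies_\<Sigma>_f_iff:
  "satisfies v \<Sigma>_f \<longleftrightarrow> \<not> (\<exists>p s. awalk root p s \<and> label s = Sink False \<and> follows v p)"
proof -
  have "satisfies v \<Sigma>_f \<longleftrightarrow> (\<forall>p s. awalk root p s \<and> label s = Sink False \<longrightarrow>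
      (\<exists>l\<in>neg ` path_literals p. lit_true v l))"
    unfolding satisfies_def \<Sigma>_f_def off_set_def by blast
  then show ?thesis
    using falsifies_path_clause_iff by blast
qed

text \<open>\<open>v\<close> follows some path to the sink labeled with the class of its
  restriction. By uniqueness of the sink, it follows a path to a 0-sink only if that class is
  0.\<close>

lemma satisfies_\<Sigma>_f_iff_class:
  assumes "represents f"
  shows "satisfies v \<Sigma>_f \<longleftrightarrow> f (restrict v {1..n})"
proof -
  let ?y = "restrict v {1..n}"
  have "?y \<in> instances n"
    by (simp add: instances_def)
  then obtain p s where p: "awalk root p s" "follows ?y p" "label s = Sink (f ?y)"
    using assms unfolding represents_def follows_def by blast
  then have v: "follows v p"
    using follows_restrict by blast
  have "\<not> f ?y" if "awalk root q t" "label t = Sink False" "follows v q" for q t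
    using follows_unique_sink[OF p(1,3) v that] p(3) that(2) by simp
  moreover have "\<exists>q t. awalk root q t \<and> label t = Sink False \<and> follows v q" if "\<not> f ?y"
    using p(1,3) v that by auto
  ultimately show ?thesis
    unfolding satisfies_\<Sigma>_f_iff by blast
qed

text \<open>Dropping the clauses of \<open>e\<close> permits a model to differ from \<open>x\<close>
  on \<open>e\<close> but does not force it to. Hence a subset \<open>e'\<close> appears: the
  literals of \<open>x\<close> that the model falsifies. Conversely, \<open>flip x e'\<close> is
  itself a model.\<close>

lemma satisfiable_relaxed_iff:
  assumes "represents f" and x: "x \<in> instances n" and e: "e \<subseteq> instance_literals n x"
  shows "satisfiable (\<Sigma>_f \<union> unit_clauses (instance_literals n x - e)) \<longleftrightarrow>
    (\<exists>e'\<subseteq>e. f (flip x e'))"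
proof
  assume "satisfiable (\<Sigma>_f \<union> unit_clauses (instance_literals n x - e))"
  then obtain v where "satisfies v \<Sigma>_f" and v: "\<forall>l\<in>instance_literals n x - e. lit_true v l"
    unfolding satisfiable_def satisfies_Un satisfies_unit_clauses by blast
  then have "f (flip x {l \<in> instance_literals n x. \<not> lit_true v l})"
    using satisfies_\<Sigma>_f_iff_class[OF assms(1)] restrict_eq_flip[OF x] by simp
  moreover have "{l \<in> instance_literals n x. \<not> lit_true v l} \<subseteq> e"
    using v by blast
  ultimately show "\<exists>e'\<subseteq>e. f (flip x e')"
    by blast
next
  assume "\<exists>e'\<subseteq>e. f (flip x e')"
  then obtain e' where e': "e' \<subseteq> e" "f (flip x e')"
    by blast
  have I: "e' \<subseteq> instance_literals n x"
    using e e' by blast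
  have "restrict (flip x e') {1..n} = flip x e'"
    using flip_in_instances[OF x I] unfolding instances_def by (rule PiE_restrict)
  then have "satisfies (flip x e') \<Sigma>_f"
    using satisfies_\<Sigma>_f_iff_class[OF assms(1)] e' by simp
  moreover have "\<forall>l\<in>instance_literals n x - e. lit_true (flip x e') l"
    using lit_true_flip_iff[OF _ I] e' by blast
  ultimately show "satisfiable (\<Sigma>_f \<union> unit_clauses (instance_literals n x - e))"
    unfolding satisfiable_def satisfies_Un satisfies_unit_clauses by blast
qed

end

theorem proposition2:
  fixes G :: "('a, 'b) pre_digraph" and n :: nat
    and root :: 'a and label :: "'a \<Rightarrow> node_label" and val :: "'b \<Rightarrow> bool"
    and f :: "(nat \<Rightarrow> bool) \<Rightarrow> bool" and x :: "nat \<Rightarrow> bool"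
  assumes "obdd G n root label val"
    and "obdd.represents G n root label val f"
    and "x \<in> instances n"
    and "f x = False"
  shows "\<not> satisfiable (obdd.\<Sigma>_f G root label val \<union> \<Sigma>_x n x) \<and>
    (\<forall>e \<subseteq> instance_literals n x.
       e \<in> CF n x f \<longleftrightarrow> unit_clauses e \<in> MCS (obdd.\<Sigma>_f G root label val) (\<Sigma>_x n x))"
proof -
  interpret obdd G n root label val
    by (rule assms(1))
  note sat = satisfiable_relaxed_iff[OF assms(2,3)]
  have "flip x {} = x"
    by (simp add: flip_def fun_eq_iff)
  \<comment> \<open>With nothing removed, the only candidate flip is \<open>x\<close> itself, which
    has class 0.\<close>
  then have "\<not> satisfiable (\<Sigma>_f \<union> \<Sigma>_x n x)"
    using sat[of "{}"] assms(4) by (simp add: \<Sigma>_x_def)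
  moreover have "e \<in> CF n x f \<longleftrightarrow> unit_clauses e \<in> MCS \<Sigma>_f (\<Sigma>_x n x)"
    if e: "e \<subseteq> instance_literals n x" for e
  proof -
    have "unit_clauses e \<in> MCS \<Sigma>_f (\<Sigma>_x n x) \<longleftrightarrow>
        (\<exists>e'\<subseteq>e. f (flip x e')) \<and> (\<forall>l\<in>e. \<not> (\<exists>e'\<subseteq>e - {l}. f (flip x e')))"
      using e sat by (simp add: \<Sigma>_x_def MCS_unit_clauses_iff subset_iff)
    also have "\<dots> \<longleftrightarrow> f (flip x e) \<and> \<not> (\<exists>e'\<subset>e. f (flip x e'))"
    proof -
      \<comment> \<open>A strict subset of \<open>e\<close> misses some \<open>l\<close> of
        \<open>e\<close>, so testing single restored literals covers all strict subsets, without any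
        monotonicity of \<open>f\<close>.\<close>
      have "(\<exists>l\<in>e. \<exists>e'\<subseteq>e - {l}. f (flip x e')) \<longleftrightarrow> (\<exists>e'\<subset>e. f (flip x e'))"
        by blast
      \<comment> \<open>If no strict subset yields class 1, the subset that does must be
        \<open>e\<close> itself.\<close>
      then show ?thesis
        unfolding subset_iff_psubset_eq[of _ e] by blast
    qed
    also have "\<dots> \<longleftrightarrow> e \<in> CF n x f"
      using e assms(4) by (auto simp: CF_def)
    finally show ?thesis
      by blast
  qed
  ultimately show ?thesis
    by blast
qed

end
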